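(* Let $j\in\{2,3,4\}$, $\lambda\in\{1,-1\}$, let $r>0$ be constant, and let $\beta$ be a unit-speed spacelike curve in $\mathbb{E}^4_1$ with non-null Frenet frame $\{F_1,F_2,F_3,F_4\}$ whose timelike member is $F_j$. Let $M$ be the tubular hypersurface $$\mathcal{T}^{\{j,\lambda\}}(s,t,w)=\beta(s)+r\sum_{i=2}^4\mu_i^{\lambda}F_i(s)$$ with Gauss map $N^{\{j,\lambda\}}=-(-1)^{(4-j)!}\lambda^j\sum_{i=2}^4\mu_i^\lambda F_i$. Then $M$ does not have generalized $\mathcal{L}_2$ 1-type Gauss map; that is, there do not exist non-zero smooth functions $\mathfrak{m},\mathfrak{n}$ on $M$ and a non-zero constant vector $C\in\mathbb{E}^4_1$ such that $\mathcal{L}_2N^{\{j,\lambda\}}=\mathfrak{m}N^{\{j,\lambda\}}+\mathfrak{n}C$.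
   Context: $\mathbb{E}^4_1$ is $\mathbb{R}^4$ with the metric $\langle\ ,\ \rangle=-dx_1^2+dx_2^2+dx_3^2+dx_4^2$. The curve $\beta:I\to\mathbb{E}^4_1$ ($I$ an open interval) is smooth with $\beta'=F_1$, and $\{F_1,\dots,F_4\}$ is a smooth orthonormal frame along $\beta$ with $\langle F_j,F_j\rangle=-1$ and $\langle F_i,F_i\rangle=1$ for $i\neq j$, satisfying, with smooth curvature functions $k_1,k_2,k_3$ of $s$, the Frenet equations - $j=2$: $F_1'=k_1F_2$, $F_2'=k_1F_1+k_2F_3$, $F_3'=k_2F_2+k_3F_4$, $F_4'=-k_3F_3$; - $j=3$: $F_1'=k_1F_2$, $F_2'=-k_1F_1+k_2F_3$, $F_3'=k_2F_2+k_3F_4$, $F_4'=k_3F_3$; - $j=4$: $F_1'=k_1F_2$, $F_2'=-k_1F_1+k_2F_3$, $F_3'=-k_2F_2+k_3F_4$, $F_4'=k_3F_3$. The functions $\mu_i^\lambda$ (depending on $j$) are given by $\mu_j^\lambda=(\sinh w)^{\frac{1+\lambda}2}(\cosh w)^{\frac{1-\lambda}2}\cosh t$, $\mu_{j+1}^\lambda=(\sinh w)^{\frac{1-\lambda}2}(\cosh w)^{\frac{1+\lambda}2}$, $\mu_{j+2}^\lambda=(\sinh w)^{\frac{1+\lambda}2}(\cosh w)^{\frac{1-\lambda}2}\sinh t$, with the index convention $\mu_5^\lambda=\mu_2^\lambda$, $\mu_6^\lambda=\mu_3^\lambda$. ($\lambda=1$: envelope of pseudo hyperspheres; $\lambda=-1$: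 envelope of pseudo hyperbolic hyperspheres, of radius $r$ centered on $\beta$.) The parameters $(s,t,w)$ range over a connected open set $U\subset I\times\mathbb{R}^2$ projecting onto $I$ on which $\mathcal{T}^{\{j,\lambda\}}$ is an immersion, i.e. $(\mu_{j+1}^\lambda)_w\neq0$ and $1+(-1)^{(4-j)!}rk_1\mu_2^\lambda\neq0$. The unit normal $N=N^{\{j,\lambda\}}$ has $\varepsilon=\langle N,N\rangle=\lambda$, and the principal curvatures with respect to $N$ (eigenvalues of $-dN$) are $\kappa_1=\kappa_2=\frac{(-1)^{(4-j)!}\lambda^j}{r}$, $\kappa_3=\frac{k_1\mu_2^\lambda}{\lambda^j(1+(-1)^{(4-j)!}rk_1\mu_2^\lambda)}$. Operator $\mathcal{L}_2$ on the Gauss map: put $a_1=-\sum_i\kappa_i$, $a_k=(-1)^k\sum_{i_1<\dots<i_k}\kappa_{i_1}\cdots\kappa_{i_k}$ ($k=2,3$), and define $H_k$ by $\binom{3}{k}H_k=(-\varepsilon)^ka_k$. Then $$\mathcal{L}_2N=-\varepsilon\,\mathfrak{C}_2\big(\nabla H_3+3H_1H_3\,N\big),\qquad \mathfrak{C}_2=\binom33(-\varepsilon)^2=1,$$ where $\nabla$ is the gradient on $M$ with respect to the induced metric, viewed as an $\mathbb{E}^4_1$-valued map. "Non-zero function" means not identically zero. *)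

theory Defs
  imports "HOL-Analysis.Analysis"
begin

text \<open>\<open>C\<^sup>n\<close> and \<open>C\<^sup>\<infinity>\<close> maps; only used for open \<open>S\<close>, where \<open>at x\<close> sees a full neighbourhood in \<open>S\<close>.\<close>

primrec n_times_continuously_differentiable_on ::
  "nat \<Rightarrow> 'a::real_normed_vector set \<Rightarrow> ('a \<Rightarrow> 'b::real_normed_vector) \<Rightarrow> bool" where
  "n_times_continuously_differentiable_on 0 S f \<longleftrightarrow> continuous_on S f"
| "n_times_continuously_differentiable_on (Suc n) S f \<longleftrightarrow>
     (\<forall>x\<in>S. f differentiable (at x)) \<and>
     (\<forall>v. n_times_continuously_differentiable_on n S (\<lambda>x. frechet_derivative f (at x) v))"

definition smooth_on :: "'a::real_normed_vector set \<Rightarrow> ('a \<Rightarrow> 'b::real_normed_vector) \<Rightarrow> bool" where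
  "smooth_on S f \<longleftrightarrow> (\<forall>n. n_times_continuously_differentiable_on n S f)"

definition minkowski :: "real^4 \<Rightarrow> real^4 \<Rightarrow> real" where
  "minkowski x y = - (x$1 * y$1) + x$2 * y$2 + x$3 * y$3 + x$4 * y$4"


section \<open>Parametrized hypersurfaces of Minkowski 4-space\<close>

text \<open>A hypersurface is given by a map \<open>X\<close> from parameters \<open>p :: real^3\<close> to \<open>real^4\<close>;
  functions on the hypersurface are functions of the parameters.\<close>

definition immersion_on :: "(real^3) set \<Rightarrow> (real^3 \<Rightarrow> real^4) \<Rightarrow> bool" where
  "immersion_on U X \<longleftrightarrow> smooth_on U X \<and> (\<forall>p\<in>U. inj (frechet_derivative X (at p)))"

text \<open>The matrix, in the coordinate basis of the tangent space, of the shape operator \<open>-dN\<close>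
  (the ambient connection is flat).\<close>

definition shape_matrix :: "(real^3 \<Rightarrow> real^4) \<Rightarrow> (real^3 \<Rightarrow> real^4) \<Rightarrow> real^3 \<Rightarrow> real^3^3" where
  "shape_matrix X N p = (THE A. \<forall>v.
     frechet_derivative X (at p) (A *v v) = - frechet_derivative N (at p) v)"

text \<open>The three eigenvalues of the shape operator, listed with algebraic multiplicity.  They are
  determined up to order only; everything below is symmetric in them.  (In Lorentzian signature
  real eigenvalues need not exist in general, in which case the value is unspecified.)\<close>

definition principal_curvatures ::
  "(real^3 \<Rightarrow> real^4) \<Rightarrow> (real^3 \<Rightarrow> real^4) \<Rightarrow> real^3 \<Rightarrow> 3 \<Rightarrow> real" where
  "principal_curvatures X N p = (SOME \<kappa>. \<forall>x.
     det (mat x - shape_matrix X N p) = (\<Prod>i\<in>UNIV. x - \<kappa> i))"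

definition curvature_coeff ::
  "(real^3 \<Rightarrow> real^4) \<Rightarrow> (real^3 \<Rightarrow> real^4) \<Rightarrow> nat \<Rightarrow> real^3 \<Rightarrow> real" where
  "curvature_coeff X N k p =
     (-1) ^ k * (\<Sum>S | card S = k. \<Prod>i\<in>S. principal_curvatures X N p i)"

definition normal_sign :: "(real^3 \<Rightarrow> real^4) \<Rightarrow> real^3 \<Rightarrow> real" where
  "normal_sign N p = minkowski (N p) (N p)"

definition mean_curvature ::
  "(real^3 \<Rightarrow> real^4) \<Rightarrow> (real^3 \<Rightarrow> real^4) \<Rightarrow> nat \<Rightarrow> real^3 \<Rightarrow> real" where
  "mean_curvature X N k p =
     (- normal_sign N p) ^ k * curvature_coeff X N k p / real (3 choose k)"

text \<open>The gradient for the induced (nondegenerate) metric, as a vector of \<open>real^4\<close> tangent to \<open>X\<close>.\<close>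

definition surface_gradient :: "(real^3 \<Rightarrow> real^4) \<Rightarrow> (real^3 \<Rightarrow> real) \<Rightarrow> real^3 \<Rightarrow> real^4" where
  "surface_gradient X f p = (THE G. G \<in> range (frechet_derivative X (at p)) \<and>
     (\<forall>v. minkowski G (frechet_derivative X (at p) v) = frechet_derivative f (at p) v))"

definition L2_gauss_map ::
  "(real^3 \<Rightarrow> real^4) \<Rightarrow> (real^3 \<Rightarrow> real^4) \<Rightarrow> real^3 \<Rightarrow> real^4" where
  "L2_gauss_map X N p =
     - (normal_sign N p * (real (3 choose 3) * (- normal_sign N p) ^ 2)) *\<^sub>R
       (surface_gradient X (mean_curvature X N 3) p +
        (3 * mean_curvature X N 1 p * mean_curvature X N 3 p) *\<^sub>R N p)"

definition generalized_L2_1_type_gauss_map ::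
  "(real^3) set \<Rightarrow> (real^3 \<Rightarrow> real^4) \<Rightarrow> (real^3 \<Rightarrow> real^4) \<Rightarrow> bool" where
  "generalized_L2_1_type_gauss_map U X N \<longleftrightarrow>
     (\<exists>(m :: real^3 \<Rightarrow> real) (n :: real^3 \<Rightarrow> real) (C :: real^4).
        smooth_on U m \<and> smooth_on U n \<and>
        (\<exists>p\<in>U. m p \<noteq> 0) \<and> (\<exists>p\<in>U. n p \<noteq> 0) \<and> C \<noteq> 0 \<and>
        (\<forall>p\<in>U. L2_gauss_map X N p = m p *\<^sub>R N p + n p *\<^sub>R C))"


section \<open>Framed curves and tubular hypersurfaces\<close>

text \<open>\<open>F i\<close> is used for \<open>i\<close> in \<open>{1..4}\<close>, \<open>k i\<close> for \<open>i\<close> in \<open>{1..3}\<close>; \<open>F j\<close> is the timelike member.\<close>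

definition frenet_curve ::
  "nat \<Rightarrow> real set \<Rightarrow> (real \<Rightarrow> real^4) \<Rightarrow> (nat \<Rightarrow> real \<Rightarrow> real^4) \<Rightarrow> (nat \<Rightarrow> real \<Rightarrow> real) \<Rightarrow> bool" where
  "frenet_curve j I \<beta> F k \<longleftrightarrow>
     smooth_on I \<beta> \<and> (\<forall>i\<in>{1..4}. smooth_on I (F i)) \<and> (\<forall>i\<in>{1..3}. smooth_on I (k i)) \<and>
     (\<forall>s\<in>I.
        (\<forall>i\<in>{1..4}. \<forall>l\<in>{1..4}. minkowski (F i s) (F l s) =
           (if i \<noteq> l then 0 else if i = j then -1 else 1)) \<and>
        (\<beta> has_vector_derivative F 1 s) (at s) \<and>
        (F 1 has_vector_derivative k 1 s *\<^sub>R F 2 s) (at s) \<and>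
        (j = 2 \<longrightarrow>
          (F 2 has_vector_derivative k 1 s *\<^sub>R F 1 s + k 2 s *\<^sub>R F 3 s) (at s) \<and>
          (F 3 has_vector_derivative k 2 s *\<^sub>R F 2 s + k 3 s *\<^sub>R F 4 s) (at s) \<and>
          (F 4 has_vector_derivative - k 3 s *\<^sub>R F 3 s) (at s)) \<and>
        (j = 3 \<longrightarrow>
          (F 2 has_vector_derivative - k 1 s *\<^sub>R F 1 s + k 2 s *\<^sub>R F 3 s) (at s) \<and>
          (F 3 has_vector_derivative k 2 s *\<^sub>R F 2 s + k 3 s *\<^sub>R F 4 s) (at s) \<and>
          (F 4 has_vector_derivative k 3 s *\<^sub>R F 3 s) (at s)) \<and>
        (j = 4 \<longrightarrow>
          (F 2 has_vector_derivative - k 1 s *\<^sub>R F 1 s + k 2 s *\<^sub>R F 3 s) (at s) \<and>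
          (F 3 has_vector_derivative - k 2 s *\<^sub>R F 2 s + k 3 s *\<^sub>R F 4 s) (at s) \<and>
          (F 4 has_vector_derivative k 3 s *\<^sub>R F 3 s) (at s)))"

text \<open>Indices are read cyclically in \<open>{2,3,4}\<close>.\<close>

definition wrap_index :: "nat \<Rightarrow> nat" where
  "wrap_index i = (if i > 4 then i - 3 else i)"

text \<open>For \<open>lam = 1\<close> or \<open>-1\<close> the exponents are 0 or 1; integer powers are used (and not \<open>powr\<close>)
  since \<open>sinh w\<close> may be negative or zero.\<close>

definition mu :: "nat \<Rightarrow> int \<Rightarrow> nat \<Rightarrow> real \<Rightarrow> real \<Rightarrow> real" where
  "mu j lam i t w =
     (if i = wrap_index j then
        sinh w powi ((1 + lam) div 2) * cosh w powi ((1 - lam) div 2) * cosh t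
      else if i = wrap_index (j + 1) then
        sinh w powi ((1 - lam) div 2) * cosh w powi ((1 + lam) div 2)
      else if i = wrap_index (j + 2) then
        sinh w powi ((1 + lam) div 2) * cosh w powi ((1 - lam) div 2) * sinh t
      else 0)"

text \<open>A parameter point \<open>p\<close> is \<open>(s, t, w) = (p$1, p$2, p$3)\<close>.\<close>

definition tube ::
  "(real \<Rightarrow> real^4) \<Rightarrow> (nat \<Rightarrow> real \<Rightarrow> real^4) \<Rightarrow> real \<Rightarrow> nat \<Rightarrow> int \<Rightarrow> real^3 \<Rightarrow> real^4" where
  "tube \<beta> F r j lam p =
     \<beta> (p$1) + r *\<^sub>R (\<Sum>i=2..4. mu j lam i (p$2) (p$3) *\<^sub>R F i (p$1))"

definition tube_gauss_map ::
  "(nat \<Rightarrow> real \<Rightarrow> real^4) \<Rightarrow> nat \<Rightarrow> int \<Rightarrow> real^3 \<Rightarrow> real^4" where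
  "tube_gauss_map F j lam p =
     - ((-1) ^ fact (4 - j) * of_int lam ^ j) *\<^sub>R
       (\<Sum>i=2..4. mu j lam i (p$2) (p$3) *\<^sub>R F i (p$1))"

end

theory Submission
  imports Defs
begin

text \<open>Write \<open>X = \<beta> + r P\<close> and \<open>N = -c P\<close> with \<open>P = \<Sum> \<mu>\<^sub>i F\<^sub>i\<close>. The curvature \<open>H\<^sub>3\<close> depends only on \<open>k\<^sub>1 \<mu>\<^sub>2\<close>, so its
  gradient lies in the span of \<open>F\<^sub>1\<close>, \<open>F\<^sub>2\<close> and \<open>P\<close>. If \<open>L\<^sub>2 N = m N + n C\<close>, then \<open>n C\<close> lies there too.
  For fixed \<open>s\<close> the functions \<open>1, \<mu>\<^sub>2, \<mu>\<^sub>3, \<mu>\<^sub>4\<close> of \<open>(t, w)\<close> are linearly independent on every open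
  set, whereas the products \<open>C\<^sub>i = \<langle>C, F\<^sub>i\<rangle>\<close> depend on \<open>s\<close> alone. Where \<open>n \<noteq> 0\<close> this forces
  \<open>C\<^sub>3 = C\<^sub>4 = 0\<close>, so the \<open>P\<close>-part of \<open>n C\<close> vanishes; differentiating \<open>C\<^sub>3 = 0\<close> gives \<open>k\<^sub>2 C\<^sub>2 = 0\<close>, and
  comparing the \<open>F\<^sub>1\<close>- and \<open>F\<^sub>2\<close>-parts then gives \<open>k\<^sub>1 C\<^sub>1 = 0\<close>. If \<open>C\<^sub>2\<close> is nonzero somewhere, then so is
  \<open>k\<^sub>1\<close>, hence \<open>C\<^sub>1 = 0\<close> nearby and \<open>0 = C\<^sub>1' = k\<^sub>1 C\<^sub>2\<close>, a contradiction. If \<open>C\<^sub>2 = 0\<close> throughout, then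
  \<open>k\<^sub>1 = 0\<close>, the gradient vanishes, and \<open>C = 0\<close>.\<close>

section \<open>Smooth maps and Frechet derivatives\<close>

lemma smooth_on_imp_differentiable:
  assumes "smooth_on S f" "x \<in> S"
  shows "f differentiable (at x)"
proof -
  have "n_times_continuously_differentiable_on (Suc 0) S f"
    using assms(1) unfolding smooth_on_def by blast
  then show ?thesis using assms(2) by simp
qed

lemma smooth_on_imp_continuous_on: "smooth_on S f \<Longrightarrow> continuous_on S f"
  unfolding smooth_on_def by (metis n_times_continuously_differentiable_on.simps(1))

lemma frechet_derivative_apply:
  "(f has_derivative f') (at x) \<Longrightarrow> frechet_derivative f (at x) v = f' v"
  by (drule frechet_derivative_at) simp

section \<open>The Minkowski form\<close>

lemma bounded_bilinear_minkowski: "bounded_bilinear minkowski"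
proof -
  have "bilinear minkowski"
    unfolding bilinear_def minkowski_def
    by (auto intro!: linearI simp: algebra_simps)
  then show ?thesis by (simp add: bilinear_conv_bounded_bilinear)
qed

lemma minkowski_commute: "minkowski x y = minkowski y x"
  unfolding minkowski_def by (simp add: algebra_simps)

lemmas minkowski_simps =
  bounded_bilinear.add_left[OF bounded_bilinear_minkowski]
  bounded_bilinear.add_right[OF bounded_bilinear_minkowski]
  bounded_bilinear.diff_left[OF bounded_bilinear_minkowski]
  bounded_bilinear.diff_right[OF bounded_bilinear_minkowski]
  bounded_bilinear.minus_left[OF bounded_bilinear_minkowski]
  bounded_bilinear.minus_right[OF bounded_bilinear_minkowski]
  bounded_bilinear.scaleR_left[OF bounded_bilinear_minkowski]
  bounded_bilinear.scaleR_right[OF bounded_bilinear_minkowski]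
  bounded_bilinear.zero_left[OF bounded_bilinear_minkowski]
  bounded_bilinear.zero_right[OF bounded_bilinear_minkowski]

lemma minkowski_nondegenerate:
  assumes "\<And>y. minkowski x y = 0"
  shows "x = 0"
proof -
  have "x $ i = 0" for i
    using assms[of "axis 1 1"] assms[of "axis 2 1"] assms[of "axis 3 1"] assms[of "axis 4 1"]
      exhaust_4[of i]
    by (auto simp: minkowski_def axis_def)
  then show ?thesis by (simp add: vec_eq_iff)
qed

section \<open>Coordinates of the tube\<close>

lemma mu_1:
  "mu j 1 i t w = (if i = wrap_index j then sinh w * cosh t
     else if i = wrap_index (j + 1) then cosh w
     else if i = wrap_index (j + 2) then sinh w * sinh t else 0)"
  by (simp add: mu_def)

lemma mu_minus_1:
  "mu j (-1) i t w = (if i = wrap_index j then cosh w * cosh t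
     else if i = wrap_index (j + 1) then sinh w
     else if i = wrap_index (j + 2) then cosh w * sinh t else 0)"
  by (simp add: mu_def)

lemma differentiable_mu:
  assumes "lam \<in> {1, -1}"
  shows "(\<lambda>q::real^3. mu j lam i (q$2) (q$3)) differentiable (at p)"
proof -
  have nth: "((\<lambda>q::real^3. q$l) has_derivative (\<lambda>v. v$l)) (at p)" for l
    by (rule bounded_linear_imp_has_derivative[OF bounded_linear_vec_nth])
  have comp: "(\<lambda>q::real^3. f (q$l)) differentiable (at p)"
    if "(f has_real_derivative D) (at (p$l))" for f :: "real \<Rightarrow> real" and l D
    using has_derivative_compose[OF nth that[unfolded has_field_derivative_def]]
    by (auto simp: differentiable_def)
  have sinh: "(\<lambda>q::real^3. sinh (q$l)) differentiable (at p)" for l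
    by (rule comp[where D = "cosh (p$l)"]) (auto intro!: derivative_eq_intros)
  have cosh: "(\<lambda>q::real^3. cosh (q$l)) differentiable (at p)" for l
    by (rule comp[where D = "sinh (p$l)"]) (auto intro!: derivative_eq_intros)
  have If: "(\<lambda>q. if b then f q else g q) differentiable (at p)"
    if "f differentiable (at p)" "g differentiable (at p)" for b and f g :: "real^3 \<Rightarrow> real"
    using that by (cases b) simp_all
  from assms consider "lam = 1" | "lam = -1" by blast
  then show ?thesis
  proof cases
    case 1
    show ?thesis
      unfolding 1 mu_1
      by (intro If differentiable_mult sinh cosh differentiable_const)
  next
    case 2
    show ?thesis
      unfolding 2 mu_minus_1
      by (intro If differentiable_mult sinh cosh differentiable_const)
  qed
qed

text \<open>The two signs \<open>lam = 1\<close> and \<open>lam = -1\<close> only interchange \<open>sinh\<close> and \<open>cosh\<close>; \<open>f, g\<close> stand for either order.\<close>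

lemma hyperbolic_independent:
  fixes f g :: "real \<Rightarrow> real" and V :: "(real \<times> real) set"
  assumes f: "\<And>w. (f has_real_derivative g w) (at w)"
    and g: "\<And>w. (g has_real_derivative f w) (at w)"
    and nz: "\<And>w. f w \<noteq> 0 \<or> g w \<noteq> 0"
    and V: "open V" "z \<in> V"
    and zero: "\<And>t w. (t, w) \<in> V \<Longrightarrow> a + b * (f w * cosh t) + c * (f w * sinh t) + d * g w = 0"
  shows "a = 0 \<and> b = 0 \<and> c = 0 \<and> d = 0"
proof -
  have D1: "D = 0" if "\<And>t w. (t, w) \<in> V \<Longrightarrow> h t w = 0" "(t, w) \<in> V"
      "((\<lambda>t. h t w) has_real_derivative D) (at t)" for h :: "real \<Rightarrow> real \<Rightarrow> real" and t w D
  proof -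
    have "open ((\<lambda>t. (t, w)) -` V)"
      by (intro open_vimage V continuous_intros)
    then have "((\<lambda>t. 0) has_real_derivative D) (at t)"
      using that by (intro has_field_derivative_transform_within_open[OF that(3)]) auto
    then show "D = 0" by (metis DERIV_const DERIV_unique)
  qed
  have D2: "D = 0" if "\<And>t w. (t, w) \<in> V \<Longrightarrow> h t w = 0" "(t, w) \<in> V"
      "((\<lambda>w. h t w) has_real_derivative D) (at w)" for h :: "real \<Rightarrow> real \<Rightarrow> real" and t w D
  proof -
    have "open ((\<lambda>w. (t, w)) -` V)"
      by (intro open_vimage V continuous_intros)
    then have "((\<lambda>t. 0) has_real_derivative D) (at w)"
      using that by (intro has_field_derivative_transform_within_open[OF that(3)]) auto
    then show "D = 0" by (metis DERIV_const DERIV_unique)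
  qed
  \<comment> \<open>Differentiating in t removes the terms of \<open>a\<close> and \<open>d\<close>;
    differentiating the result in w turns \<open>f\<close> into \<open>g\<close>. Since
    \<open>f w\<close> and \<open>g w\<close> never vanish together, the common bracket is
    zero.\<close>
  have t1: "f w * (b * sinh t + c * cosh t) = 0" if "(t, w) \<in> V" for t w
    by (rule D1[OF zero that]) (auto intro!: derivative_eq_intros simp: algebra_simps)
  have t2: "g w * (b * sinh t + c * cosh t) = 0" if "(t, w) \<in> V" for t w
    by (rule D2[OF t1 that]) (auto intro!: derivative_eq_intros f simp: algebra_simps)
  have t3: "b * sinh t + c * cosh t = 0" if "(t, w) \<in> V" for t w
    using t1[OF that] t2[OF that] nz[of w] by auto
  have t4: "b * cosh t + c * sinh t = 0" if "(t, w) \<in> V" for t w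
    by (rule D1[OF t3 that]) (auto intro!: derivative_eq_intros simp: algebra_simps)
  obtain t w where z: "(t, w) \<in> V" using V by (cases z) auto
  have h: "cosh t ^ 2 = sinh t ^ 2 + 1" by (simp add: cosh_square_eq)
  \<comment> \<open>Up to sign, the system \<open>t3\<close>, \<open>t4\<close> for \<open>b\<close>
    and \<open>c\<close> has determinant cosh^2 - sinh^2 = 1.\<close>
  have "b * (cosh t ^ 2 - sinh t ^ 2) = (b * cosh t + c * sinh t) * cosh t - (b * sinh t + c * cosh t) * sinh t"
    by (simp add: algebra_simps power2_eq_square)
  then have b: "b = 0" using t3[OF z] t4[OF z] h by simp
  then have c: "c = 0" using t3[OF z] by simp
  have u0: "a + d * g w = 0" if "(t, w) \<in> V" for t w
    using zero[OF that] b c by simp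
  have u1: "d * f w = 0" if "(t, w) \<in> V" for t w
    by (rule D2[OF u0 that]) (auto intro!: derivative_eq_intros g simp: algebra_simps)
  have u2: "d * g w = 0" if "(t, w) \<in> V" for t w
    by (rule D2[OF u1 that]) (auto intro!: derivative_eq_intros f simp: algebra_simps)
  have "d = 0" using u1[OF z] u2[OF z] nz[of w] by auto
  then show ?thesis using u0[OF z] b c by simp
qed

text \<open>Fixing s cuts \<open>W\<close> in an open set of the (t, w)-plane, where
  \<open>hyperbolic_independent\<close> applies. Coefficients that depend on s alone can therefore
  be compared one by one.\<close>

lemma mu_independent:
  fixes W :: "(real^3) set"
  assumes j: "j \<in> {2, 3, 4}" and lam: "lam \<in> {1, -1}"
    and W: "open W" "p \<in> W"
    and zero: "\<And>q. q \<in> W \<Longrightarrow> q$1 = p$1 \<Longrightarrow>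
      a + b * mu j lam 2 (q$2) (q$3) + c * mu j lam 3 (q$2) (q$3) + d * mu j lam 4 (q$2) (q$3) = 0"
  shows "a = 0" "b = 0" "c = 0" "d = 0"
proof -
  define pt :: "real \<times> real \<Rightarrow> real^3"
    where "pt z = p$1 *\<^sub>R axis 1 1 + fst z *\<^sub>R axis 2 1 + snd z *\<^sub>R axis 3 1" for z
  have pt: "pt z $ 1 = p$1" "pt z $ 2 = fst z" "pt z $ 3 = snd z" for z
    by (auto simp: pt_def axis_def)
  have V: "open (pt -` W)"
    unfolding pt_def by (intro open_vimage W continuous_intros)
  have "pt (p$2, p$3) = p"
    by (auto simp: vec_eq_iff forall_3 pt)
  then have z: "(p$2, p$3) \<in> pt -` W" using W by simp
  have zero': "a + b * mu j lam 2 t w + c * mu j lam 3 t w + d * mu j lam 4 t w = 0"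
    if "(t, w) \<in> pt -` W" for t w
    using zero[of "pt (t, w)"] that by (simp add: pt)
  have sc: "(sinh has_real_derivative cosh w) (at w)" "(cosh has_real_derivative sinh w) (at w)" for w :: real
    by (auto intro!: derivative_eq_intros)
  have nz: "sinh w \<noteq> 0 \<or> cosh w \<noteq> 0" "cosh w \<noteq> 0 \<or> sinh w \<noteq> 0" for w :: real
    by auto
  note ind = hyperbolic_independent[OF sc nz(1) V z] hyperbolic_independent[OF sc(2) sc(1) nz(2) V z]
  consider "j = 2" | "j = 3" | "j = 4" using j by auto
  then have "a = 0 \<and> b = 0 \<and> c = 0 \<and> d = 0"
  proof cases
    case 1
    \<comment> \<open>The conjuncts follow the order 1, f cosh, f sinh, g of
      \<open>hyperbolic_independent\<close>: after the constant come the indices j, j + 2, j + 1,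
      read cyclically.\<close>
    have "a = 0 \<and> b = 0 \<and> d = 0 \<and> c = 0"
      using lam
    proof (elim insertE emptyE)
      assume "lam = 1"
      then show ?thesis
        using zero' by (intro ind(1)) (simp add: mu_1 mu_minus_1 wrap_index_def 1 add_ac)
    next
      assume "lam = -1"
      then show ?thesis
        using zero' by (intro ind(2)) (simp add: mu_1 mu_minus_1 wrap_index_def 1 add_ac)
    qed
    then show ?thesis by simp
  next
    case 2
    have "a = 0 \<and> c = 0 \<and> b = 0 \<and> d = 0"
      using lam
    proof (elim insertE emptyE)
      assume "lam = 1"
      then show ?thesis
        using zero' by (intro ind(1)) (simp add: mu_1 mu_minus_1 wrap_index_def 2 add_ac)
    next
      assume "lam = -1"
      then show ?thesis
        using zero' by (intro ind(2)) (simp add: mu_1 mu_minus_1 wrap_index_def 2 add_ac)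
    qed
    then show ?thesis by simp
  next
    case 3
    have "a = 0 \<and> d = 0 \<and> c = 0 \<and> b = 0"
      using lam
    proof (elim insertE emptyE)
      assume "lam = 1"
      then show ?thesis
        using zero' by (intro ind(1)) (simp add: mu_1 mu_minus_1 wrap_index_def 3 add_ac)
    next
      assume "lam = -1"
      then show ?thesis
        using zero' by (intro ind(2)) (simp add: mu_1 mu_minus_1 wrap_index_def 3 add_ac)
    qed
    then show ?thesis by simp
  qed
  then show "a = 0" "b = 0" "c = 0" "d = 0" by auto
qed

text \<open>A short move from \<open>p\<close> in the direction of s stays in \<open>W\<close>, so
  \<open>g\<close> vanishes near \<open>p$1\<close>. This lets relations between functions of s,
  known only at points of \<open>W\<close>, be differentiated.\<close>

lemma vanishing_derivative:
  fixes W :: "(real^3) set" and g :: "real \<Rightarrow> real"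
  assumes W: "open W" "p \<in> W" and zero: "\<And>q. q \<in> W \<Longrightarrow> g (q$1) = 0"
    and D: "(g has_real_derivative D) (at (p$1))"
  shows "D = 0"
proof -
  define pt :: "real \<Rightarrow> real^3" where "pt x = p + (x - p$1) *\<^sub>R axis 1 1" for x
  have "open (pt -` W)"
    unfolding pt_def by (intro open_vimage W continuous_intros)
  moreover have "p$1 \<in> pt -` W" using W by (simp add: pt_def)
  moreover have "g x = 0" if "x \<in> pt -` W" for x
    using zero[of "pt x"] that by (simp add: pt_def axis_def)
  ultimately have "((\<lambda>x. 0) has_real_derivative D) (at (p$1))"
    by (intro has_field_derivative_transform_within_open[OF D]) auto
  then show "D = 0" by (metis DERIV_const DERIV_unique)
qed

text \<open>This is how H_3 depends on x = k_1 mu_2, with a = r e_2.\<close>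

lemma moebius_has_derivative:
  fixes a x K :: real
  assumes "1 - a * x \<noteq> 0"
  shows "((\<lambda>x. K * (x / (1 - a * x))) has_real_derivative K / (1 - a * x)^2) (at x)"
proof -
  have "((\<lambda>x. K * (x / (1 - a * x))) has_real_derivative
      K * ((1 * (1 - a * x) - x * (0 - a * 1)) / ((1 - a * x) * (1 - a * x)))) (at x)"
    by (intro DERIV_cmult DERIV_divide DERIV_diff DERIV_const DERIV_ident assms)
  then show ?thesis by (simp add: power2_eq_square)
qed

lemma sum_2_4: "(\<Sum>i=2..4. f i) = f 2 + f 3 + (f (4::nat) :: 'a::comm_monoid_add)"
  by (simp add: eval_nat_numeral add.assoc)

section \<open>Tubular hypersurfaces\<close>

locale framed_tube =
  fixes j :: nat and lam :: int and r :: real and I :: "real set" and U :: "(real^3) set"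
    and \<beta> :: "real \<Rightarrow> real^4" and F :: "nat \<Rightarrow> real \<Rightarrow> real^4" and k :: "nat \<Rightarrow> real \<Rightarrow> real"
  assumes j: "j \<in> {2, 3, 4}" and lam: "lam \<in> {1, -1}" and r: "r > 0"
    and frenet: "frenet_curve j I \<beta> F k"
    and U: "open U" and proj: "\<And>p. p \<in> U \<Longrightarrow> p$1 \<in> I"
    and immersion: "immersion_on U (tube \<beta> F r j lam)"
begin

declare One_nat_def [simp del]

abbreviation X where "X \<equiv> tube \<beta> F r j lam"
abbreviation N where "N \<equiv> tube_gauss_map F j lam"
abbreviation dX where "dX p \<equiv> frechet_derivative X (at p)"

text \<open>The sign <F_i, F_i> for i from 1 to 4; it merges the three Frenet systems into
  one.\<close>

definition e :: "nat \<Rightarrow> real" where "e i = (if i = j then -1 else 1)"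

definition c :: real where "c = (-1) ^ fact (4 - j) * of_int lam ^ j"

definition \<mu> :: "nat \<Rightarrow> real^3 \<Rightarrow> real" where "\<mu> i p = mu j lam i (p$2) (p$3)"

definition P :: "real^3 \<Rightarrow> real^4"
  where "P p = \<mu> 2 p *\<^sub>R F 2 (p$1) + \<mu> 3 p *\<^sub>R F 3 (p$1) + \<mu> 4 p *\<^sub>R F 4 (p$1)"

text \<open>Component of \<open>\<partial>X/\<partial>s\<close> along \<open>F 1\<close>; \<open>- e 2\<close> is the paper's \<open>(-1)\<^bsup>(4-j)!\<^esup>\<close>.\<close>

definition A :: "real^3 \<Rightarrow> real" where "A p = 1 - r * e 2 * k 1 (p$1) * \<mu> 2 p"

definition dP where "dP p = frechet_derivative P (at p)"
definition d\<mu> where "d\<mu> i p = frechet_derivative (\<mu> i) (at p)"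

section \<open>Signs, frame products and derivatives along the tube\<close>

lemma c_square: "c * c = 1"
  using j lam by (auto simp: c_def)

lemma lam_square: "of_int lam * of_int lam = (1::real)"
  using lam by auto

lemma e_1: "e 1 = 1" using j by (auto simp: e_def)

lemma e_square: "e i * e i = 1" by (simp add: e_def)

lemma e_nonzero: "e i \<noteq> 0" by (simp add: e_def)

lemma X_eq: "X p = \<beta> (p$1) + r *\<^sub>R P p"
  by (simp add: tube_def P_def \<mu>_def sum_2_4)

lemma N_eq: "N p = - c *\<^sub>R P p"
  by (simp add: tube_gauss_map_def P_def \<mu>_def c_def sum_2_4)

lemma frame:
  assumes "s \<in> I"
  shows "minkowski (F 1 s) (F 1 s) = 1" "minkowski (F 2 s) (F 2 s) = e 2"
    "minkowski (F 3 s) (F 3 s) = e 3" "minkowski (F 4 s) (F 4 s) = e 4"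
    "minkowski (F 1 s) (F 2 s) = 0" "minkowski (F 2 s) (F 1 s) = 0"
    "minkowski (F 1 s) (F 3 s) = 0" "minkowski (F 3 s) (F 1 s) = 0"
    "minkowski (F 1 s) (F 4 s) = 0" "minkowski (F 4 s) (F 1 s) = 0"
    "minkowski (F 2 s) (F 3 s) = 0" "minkowski (F 3 s) (F 2 s) = 0"
    "minkowski (F 2 s) (F 4 s) = 0" "minkowski (F 4 s) (F 2 s) = 0"
    "minkowski (F 3 s) (F 4 s) = 0" "minkowski (F 4 s) (F 3 s) = 0"
proof -
  have *: "minkowski (F i s) (F l s) = (if i = l then e i else 0)"
    if "i \<in> {1..4}" "l \<in> {1..4}" for i l
    using frenet assms that unfolding frenet_curve_def e_def by auto
  show "minkowski (F 1 s) (F 1 s) = 1" "minkowski (F 2 s) (F 2 s) = e 2"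
    "minkowski (F 3 s) (F 3 s) = e 3" "minkowski (F 4 s) (F 4 s) = e 4"
    "minkowski (F 1 s) (F 2 s) = 0" "minkowski (F 2 s) (F 1 s) = 0"
    "minkowski (F 1 s) (F 3 s) = 0" "minkowski (F 3 s) (F 1 s) = 0"
    "minkowski (F 1 s) (F 4 s) = 0" "minkowski (F 4 s) (F 1 s) = 0"
    "minkowski (F 2 s) (F 3 s) = 0" "minkowski (F 3 s) (F 2 s) = 0"
    "minkowski (F 2 s) (F 4 s) = 0" "minkowski (F 4 s) (F 2 s) = 0"
    "minkowski (F 3 s) (F 4 s) = 0" "minkowski (F 4 s) (F 3 s) = 0"
    using e_1 by (auto simp: *)
qed

text \<open>By orthonormality the coefficient of F_i in F_l' is - e_i e_l times that of F_l in F_i'.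
  This is the common form of the three sign patterns.\<close>

lemma frenet_equations:
  assumes "s \<in> I"
  shows "(\<beta> has_vector_derivative F 1 s) (at s)"
    and "(F 1 has_vector_derivative k 1 s *\<^sub>R F 2 s) (at s)"
    and "(F 2 has_vector_derivative - (e 2 * k 1 s) *\<^sub>R F 1 s + k 2 s *\<^sub>R F 3 s) (at s)"
    and "(F 3 has_vector_derivative - (e 2 * e 3 * k 2 s) *\<^sub>R F 2 s + k 3 s *\<^sub>R F 4 s) (at s)"
    and "(F 4 has_vector_derivative - (e 3 * e 4 * k 3 s) *\<^sub>R F 3 s) (at s)"
  using frenet assms j unfolding frenet_curve_def e_def by (auto simp: add.commute)

lemma k1_differentiable: "s \<in> I \<Longrightarrow> k 1 differentiable (at s)"
  using frenet smooth_on_imp_differentiable[of I "k 1" s] unfolding frenet_curve_def by auto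

text \<open>cosh^2 - sinh^2 = 1 is applied first in t and then in w: the timelike index j carries
  the factor cosh t, the index j + 2 the factor sinh t.\<close>

lemma minkowski_P_P:
  assumes "p \<in> U"
  shows "minkowski (P p) (P p) = of_int lam"
proof -
  have h: "(x * cosh t)^2 = x^2 + (x * sinh t)^2" "(cosh t)^2 = 1 + (sinh t)^2" for x t :: real
    by (simp_all add: power_mult_distrib cosh_square_eq distrib_left)
  have "minkowski (P p) (P p) = e 2 * (\<mu> 2 p)^2 + e 3 * (\<mu> 3 p)^2 + e 4 * (\<mu> 4 p)^2"
    by (simp add: P_def minkowski_simps frame[OF proj[OF assms]] power2_eq_square)
  also have "\<dots> = of_int lam"
    unfolding \<mu>_def e_def using j lam
    by (elim insertE emptyE) (simp_all add: mu_1 mu_minus_1 wrap_index_def h)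
  finally show ?thesis .
qed

lemma minkowski_P_F:
  assumes "p \<in> U"
  shows "minkowski (P p) (F 1 (p$1)) = 0" "minkowski (P p) (F 2 (p$1)) = e 2 * \<mu> 2 p"
    "minkowski (P p) (F 3 (p$1)) = e 3 * \<mu> 3 p" "minkowski (P p) (F 4 (p$1)) = e 4 * \<mu> 4 p"
  by (simp_all add: P_def minkowski_simps frame[OF proj[OF assms]])

lemma mu_has_derivative: "(\<mu> i has_derivative d\<mu> i p) (at p)"
  using differentiable_mu[OF lam, of j i p] unfolding d\<mu>_def \<mu>_def[abs_def]
  by (simp add: frechet_derivative_works)

lemma nth_has_derivative: "((\<lambda>q::real^3. q$l) has_derivative (\<lambda>v. v$l)) (at p)"
  by (rule bounded_linear_imp_has_derivative[OF bounded_linear_vec_nth])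

lemma has_derivative_comp_nth:
  fixes f :: "real \<Rightarrow> 'b::real_normed_vector" and p :: "real^3"
  assumes "(f has_vector_derivative D) (at (p$1))"
  shows "((\<lambda>q. f (q$1)) has_derivative (\<lambda>v. v$1 *\<^sub>R D)) (at p)"
  using has_derivative_compose[OF nth_has_derivative[of 1 p], of f "\<lambda>x. x *\<^sub>R D"] assms
  unfolding has_vector_derivative_def by (simp add: o_def)

lemma P_has_derivative_explicit:
  assumes "p \<in> U"
  shows "(P has_derivative (\<lambda>v.
     (\<mu> 2 p *\<^sub>R v$1 *\<^sub>R (- (e 2 * k 1 (p$1)) *\<^sub>R F 1 (p$1) + k 2 (p$1) *\<^sub>R F 3 (p$1)) + d\<mu> 2 p v *\<^sub>R F 2 (p$1)) +
     (\<mu> 3 p *\<^sub>R v$1 *\<^sub>R (- (e 2 * e 3 * k 2 (p$1)) *\<^sub>R F 2 (p$1) + k 3 (p$1) *\<^sub>R F 4 (p$1)) + d\<mu> 3 p v *\<^sub>R F 3 (p$1)) +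
     (\<mu> 4 p *\<^sub>R v$1 *\<^sub>R (- (e 3 * e 4 * k 3 (p$1)) *\<^sub>R F 3 (p$1)) + d\<mu> 4 p v *\<^sub>R F 4 (p$1)))) (at p)"
  unfolding P_def[abs_def]
  by (intro has_derivative_add has_derivative_scaleR mu_has_derivative has_derivative_comp_nth
      frenet_equations proj[OF assms])

lemma P_has_derivative: "p \<in> U \<Longrightarrow> (P has_derivative dP p) (at p)"
  using P_has_derivative_explicit[of p] unfolding dP_def frechet_derivative_works[symmetric]
  by (auto simp: differentiable_def)

text \<open>These two components suffice for the shape operator and for pairing with
  \<open>Y\<close>, which lies in the span of F_1 and F_2.\<close>

lemma minkowski_dP_F:
  assumes "p \<in> U"
  shows "minkowski (dP p v) (F 1 (p$1)) = - (v$1 * e 2 * k 1 (p$1) * \<mu> 2 p)"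
    and "minkowski (dP p v) (F 2 (p$1)) = e 2 * d\<mu> 2 p v - v$1 * e 3 * k 2 (p$1) * \<mu> 3 p"
proof -
  note dP = has_derivative_unique[OF P_has_derivative[OF assms] P_has_derivative_explicit[OF assms]]
  show "minkowski (dP p v) (F 1 (p$1)) = - (v$1 * e 2 * k 1 (p$1) * \<mu> 2 p)"
    by (simp add: dP minkowski_simps frame[OF proj[OF assms]])
  show "minkowski (dP p v) (F 2 (p$1)) = e 2 * d\<mu> 2 p v - v$1 * e 3 * k 2 (p$1) * \<mu> 3 p"
    using e_square[of 2]
    by (simp add: dP minkowski_simps frame[OF proj[OF assms]])
qed

text \<open>The product \<open>minkowski (P q) (P q)\<close> has the constant value
  \<open>lam\<close> on the open set \<open>U\<close>, so its derivative is zero.\<close>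

lemma minkowski_P_dP:
  assumes "p \<in> U"
  shows "minkowski (P p) (dP p v) = 0"
proof -
  have "((\<lambda>q. minkowski (P q) (P q)) has_derivative
      (\<lambda>v. minkowski (P p) (dP p v) + minkowski (dP p v) (P p))) (at p)"
    by (intro bounded_bilinear.FDERIV[OF bounded_bilinear_minkowski] P_has_derivative assms)
  then have "((\<lambda>q. of_int lam) has_derivative
      (\<lambda>v. minkowski (P p) (dP p v) + minkowski (dP p v) (P p))) (at p)"
    by (rule has_derivative_transform_within_open[OF _ U assms]) (simp add: minkowski_P_P)
  then have "(\<lambda>v. minkowski (P p) (dP p v) + minkowski (dP p v) (P p)) = (\<lambda>v. 0)"
    using has_derivative_const has_derivative_unique by blast
  then have "minkowski (P p) (dP p v) + minkowski (dP p v) (P p) = 0" by meson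
  then show ?thesis by (simp add: minkowski_commute)
qed

lemma X_has_derivative:
  assumes "p \<in> U"
  shows "(X has_derivative (\<lambda>v. v$1 *\<^sub>R F 1 (p$1) + r *\<^sub>R dP p v)) (at p)"
proof -
  have "X = (\<lambda>p. \<beta> (p$1) + r *\<^sub>R P p)" by (auto simp: X_eq)
  then show ?thesis
    using has_derivative_add[OF has_derivative_comp_nth[OF frenet_equations(1)[OF proj[OF assms]]]
        has_derivative_scaleR_right[OF P_has_derivative[OF assms]]] by simp
qed

lemma dX_eq: "p \<in> U \<Longrightarrow> dX p v = v$1 *\<^sub>R F 1 (p$1) + r *\<^sub>R dP p v"
  by (rule frechet_derivative_apply[OF X_has_derivative])

lemma dN_eq:
  assumes "p \<in> U"
  shows "frechet_derivative N (at p) v = - c *\<^sub>R dP p v"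
proof -
  have "N = (\<lambda>p. - c *\<^sub>R P p)" by (auto simp: N_eq)
  then have "(N has_derivative (\<lambda>v. - c *\<^sub>R dP p v)) (at p)"
    using has_derivative_scaleR_right[OF P_has_derivative[OF assms]] by simp
  then show ?thesis by (rule frechet_derivative_apply)
qed

section \<open>Tangent spaces and gradients\<close>

lemma minkowski_P_dX: "p \<in> U \<Longrightarrow> minkowski (P p) (dX p v) = 0"
  by (simp add: dX_eq minkowski_simps minkowski_P_dP minkowski_P_F)

lemma linear_dX:
  assumes "p \<in> U"
  shows "linear (dX p)"
proof -
  have "(X has_derivative dX p) (at p)"
    unfolding frechet_derivative_works[symmetric] differentiable_def
    using X_has_derivative[OF assms] by blast
  then show ?thesis by (rule has_derivative_linear)
qed

lemma inj_dX: "p \<in> U \<Longrightarrow> inj (dX p)"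
  using immersion by (simp add: immersion_on_def)

text \<open>\<open>P p\<close> is orthogonal to the tangent space but not to itself, so it is
  independent of the three tangent directions and spans with them by dimension. Splitting real^4 by
  \<open>\<pi>\<close> and the fourth coordinate turns this into surjectivity of an injective
  endomorphism.\<close>

lemma tangent_decomposition:
  assumes "p \<in> U"
  shows "\<exists>v a. y = dX p v + a *\<^sub>R P p"
proof -
  define \<pi> :: "real^4 \<Rightarrow> real^3" where "\<pi> u = (\<chi> i. if i = 1 then u$1 else if i = 2 then u$2 else u$3)" for u
  define L where "L u = dX p (\<pi> u) + u$4 *\<^sub>R P p" for u
  have pi: "\<pi> (x + y) = \<pi> x + \<pi> y" "\<pi> (b *\<^sub>R x) = b *\<^sub>R \<pi> x" for x y b
    by (simp_all add: \<pi>_def vec_eq_iff)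
  have L: "linear L"
    unfolding L_def
    by (intro linearI) (simp_all add: pi linear_add[OF linear_dX[OF assms]]
        linear_cmul[OF linear_dX[OF assms]] algebra_simps)
  have "inj L"
  proof (subst linear_injective_0[OF L], intro allI impI)
    fix u assume u: "L u = 0"
    have "minkowski (P p) (L u) = u$4 * of_int lam"
      by (simp add: L_def minkowski_simps minkowski_P_dX minkowski_P_P assms)
    then have 4: "u$4 = 0" using u lam by (auto simp: minkowski_simps)
    then have "dX p (\<pi> u) = 0" using u by (simp add: L_def)
    then have "\<pi> u = 0"
      using linear_injective_0[OF linear_dX[OF assms]] inj_dX[OF assms] by auto
    then have "\<pi> u $ 1 = 0" "\<pi> u $ 2 = 0" "\<pi> u $ 3 = 0" by auto
    then show "u = 0" using 4 by (simp add: \<pi>_def vec_eq_iff forall_4)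
  qed
  then have "surj L" using L by (simp add: linear_injective_imp_surjective)
  then obtain u where "y = L u" by (rule surjE)
  then show ?thesis unfolding L_def by blast
qed

text \<open>Pairing a decomposition with \<open>P p\<close> leaves only the normal coefficient.
  Tangency thus becomes one linear equation.\<close>

lemma range_dX:
  assumes "p \<in> U"
  shows "y \<in> range (dX p) \<longleftrightarrow> minkowski (P p) y = 0"
proof
  assume "minkowski (P p) y = 0"
  moreover obtain v a where y: "y = dX p v + a *\<^sub>R P p"
    using tangent_decomposition[OF assms] by blast
  ultimately have "a * of_int lam = 0"
    by (simp add: minkowski_simps minkowski_P_dX minkowski_P_P assms)
  then have "a = 0" using lam by auto
  then show "y \<in> range (dX p)" using y by simp
qed (auto simp: minkowski_P_dX assms)

text \<open>The gradient is the tangential part of any ambient vector that represents df on tangent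
  vectors; later only its class modulo \<open>P p\<close> matters.\<close>

lemma surface_gradient_eqI:
  assumes p: "p \<in> U"
    and f: "\<And>v. frechet_derivative f (at p) v = minkowski Y (dX p v)"
  shows "\<exists>a. surface_gradient X f p = Y + a *\<^sub>R P p"
proof -
  \<comment> \<open>Division by <P, P> = \<open>lam\<close> is multiplication by \<open>lam\<close>,
    because \<open>lam\<close> is 1 or -1.\<close>
  define a where "a = - minkowski (P p) Y * of_int lam"
  let ?G = "Y + a *\<^sub>R P p"
  have "surface_gradient X f p = ?G"
    unfolding surface_gradient_def
  proof (rule the_equality)
    have "minkowski (P p) ?G = minkowski (P p) Y * (1 - of_int lam * of_int lam)"
      by (simp add: minkowski_simps minkowski_P_P p a_def algebra_simps)
    then have "?G \<in> range (dX p)"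
      by (simp add: range_dX[OF p] lam_square)
    then show "?G \<in> range (dX p) \<and>
       (\<forall>v. minkowski ?G (dX p v) = frechet_derivative f (at p) v)"
      by (simp add: minkowski_simps minkowski_P_dX p f)
    fix G assume G: "G \<in> range (dX p) \<and>
       (\<forall>v. minkowski G (dX p v) = frechet_derivative f (at p) v)"
    \<comment> \<open>Two candidates differ by a vector orthogonal to the tangent space and to
      \<open>P p\<close>, hence to everything.\<close>
    have "minkowski (G - ?G) y = 0" for y
    proof -
      obtain v b where y: "y = dX p v + b *\<^sub>R P p"
        using tangent_decomposition[OF p] by blast
      have "minkowski (G - ?G) (P p) = 0"
        using G \<open>?G \<in> range (dX p)\<close> unfolding range_dX[OF p] minkowski_commute[of "G - ?G"]
        by (simp add: bounded_bilinear.diff_right[OF bounded_bilinear_minkowski])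
      moreover have "minkowski (G - ?G) (dX p v) = 0"
        using G by (simp add: minkowski_simps minkowski_P_dX p f)
      ultimately show ?thesis
        by (simp only: y bounded_bilinear.add_right[OF bounded_bilinear_minkowski]
            bounded_bilinear.scaleR_right[OF bounded_bilinear_minkowski]) simp
    qed
    then show "G = ?G" using minkowski_nondegenerate[of "G - ?G"] by simp
  qed
  then show ?thesis by blast
qed

section \<open>Shape operator and principal curvatures\<close>

text \<open>If \<open>F 1 = dX u\<close> then \<open>dX v = v\<^sub>1 F 1 + r dP v\<close> gives \<open>-dN v = (c / r) dX (v - v\<^sub>1 u)\<close>.\<close>

lemma shape_matrix_eq:
  assumes p: "p \<in> U"
  shows "\<exists>u. A p * u$1 = 1 \<and>
    shape_matrix X N p = (\<chi> i l. (c / r) * ((if i = l then 1 else 0) - (if l = 1 then u$i else 0)))"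
proof -
  have "minkowski (P p) (F 1 (p$1)) = 0" using p by (simp add: minkowski_P_F)
  then obtain u where u: "dX p u = F 1 (p$1)"
    using range_dX[OF p, of "F 1 (p$1)"] by fastforce
  \<comment> \<open>Pairing \<open>dX p u\<close> = F_1 with F_1 itself determines
    \<open>u$1\<close>.\<close>
  have "minkowski (dX p u) (F 1 (p$1)) = u$1 * A p"
    by (simp add: dX_eq p minkowski_simps minkowski_dP_F frame[OF proj[OF p]] A_def algebra_simps)
  then have 1: "A p * u$1 = 1" using u frame(1)[OF proj[OF p]] by (simp add: mult.commute)
  let ?B = "(\<chi> i l. (c / r) * ((if i = l then 1 else 0) - (if l = 1 then u$i else 0))) :: real^3^3"
  have B: "?B *v v = (c / r) *\<^sub>R (v - v$1 *\<^sub>R u)" for v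
    by (auto simp: vec_eq_iff forall_3 matrix_vector_mult_def sum_3 algebra_simps)
  have dB: "dX p (?B *v v) = - frechet_derivative N (at p) v" for v
  proof -
    have "dX p (?B *v v) = (c / r) *\<^sub>R (dX p v - v$1 *\<^sub>R dX p u)"
      using linear_dX[OF p] by (simp only: B linear_cmul linear_diff)
    also have "\<dots> = (c / r) *\<^sub>R (r *\<^sub>R dP p v)"
      by (simp only: u) (simp add: dX_eq p)
    also have "\<dots> = - frechet_derivative N (at p) v"
      using r by (simp add: dN_eq p)
    finally show ?thesis .
  qed
  have "shape_matrix X N p = ?B"
    unfolding shape_matrix_def
  proof (rule the_equality)
    show "\<forall>v. dX p (?B *v v) = - frechet_derivative N (at p) v" using dB by blast
    fix B assume "\<forall>v. dX p (B *v v) = - frechet_derivative N (at p) v"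
    then have "B *v v = ?B *v v" for v
      by (intro injD[OF inj_dX[OF p]]) (simp only: dB)
    then show "B = ?B" unfolding matrix_eq by blast
  qed
  then show ?thesis using 1 by blast
qed

text \<open>F_1 is tangent to the tube, and its first coordinate \<open>u$1\<close> inverts
  \<open>A p\<close>; the immersion property enters through \<open>shape_matrix_eq\<close>.\<close>

lemma A_nonzero: "p \<in> U \<Longrightarrow> A p \<noteq> 0"
  using shape_matrix_eq[of p] by auto

text \<open>The choice operator fixes the principal curvatures only up to order, so their product is
  read off the characteristic polynomial at 0.\<close>

lemma prod_principal_curvatures:
  assumes p: "p \<in> U"
  shows "(\<Prod>i\<in>UNIV. principal_curvatures X N p i) = - c * e 2 / r^2 * (k 1 (p$1) * \<mu> 2 p / A p)"
proof -
  obtain u where u: "A p * u$1 = 1" and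
    B: "shape_matrix X N p = (\<chi> i l. (c / r) * ((if i = l then 1 else 0) - (if l = 1 then u$i else 0)))"
    using shape_matrix_eq[OF p] by blast
  \<comment> \<open>The matrix differs from c/r times the identity only in the first column, so it
    is lower triangular.\<close>
  have det: "det (mat x - shape_matrix X N p) = (x - c / r) * (x - c / r) * (x - (c / r) * (1 - u$1))" for x
    unfolding B det_3 by (simp add: mat_def)
  \<comment> \<open>An explicit list of roots shows that the polynomial splits, so the chosen
    \<open>principal_curvatures\<close> meet their specification.\<close>
  define \<kappa>0 :: "3 \<Rightarrow> real" where "\<kappa>0 i = (if i = 1 then (c / r) * (1 - u$1) else c / r)" for i
  have "\<forall>x. det (mat x - shape_matrix X N p) = (\<Prod>i\<in>UNIV. x - \<kappa>0 i)"
    unfolding det UNIV_3 by (simp add: \<kappa>0_def)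
  then have "\<forall>x. det (mat x - shape_matrix X N p) = (\<Prod>i\<in>UNIV. x - principal_curvatures X N p i)"
    unfolding principal_curvatures_def
    by (rule someI[of "\<lambda>\<kappa>. \<forall>x. det (mat x - shape_matrix X N p) = (\<Prod>i\<in>UNIV. x - \<kappa> i)"])
  from this[rule_format, of 0] have
    "(\<Prod>i\<in>UNIV. principal_curvatures X N p i) = (c / r) * (c / r) * ((c / r) * (1 - u$1))"
    unfolding det UNIV_3 by simp
  also have "\<dots> = c * (c * c) * (1 - u$1) / r^3" by (simp add: power3_eq_cube)
  also have "\<dots> = c * (A p - 1) / A p / r^3"
  proof -
    have "1 - u$1 = (A p - 1) / A p"
      using A_nonzero[OF p] u by (simp add: field_simps)
    then show ?thesis by (simp add: c_square)
  qed
  also have "\<dots> = - c * e 2 / r^2 * (k 1 (p$1) * \<mu> 2 p / A p)"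
    using r A_nonzero[OF p] by (simp add: A_def power2_eq_square power3_eq_cube mult_ac)
  finally show ?thesis .
qed

section \<open>The curvature H_3 and the operator L_2\<close>

lemma normal_sign_eq: "p \<in> U \<Longrightarrow> normal_sign N p = of_int lam"
  by (simp add: normal_sign_def N_eq minkowski_simps minkowski_P_P c_square mult.assoc[symmetric])

definition K :: real where "K = - of_int lam * c * e 2 / r^2"

lemma K_nonzero: "K \<noteq> 0"
  using r lam c_square e_square[of 2] by (auto simp: K_def)

lemma mean_curvature_3:
  assumes "p \<in> U"
  shows "mean_curvature X N 3 p = K * (k 1 (p$1) * \<mu> 2 p / A p)"
proof -
  \<comment> \<open>\<open>UNIV\<close> is the only index set with 3 elements, so the sum has one
    term. The signs (-1)^3 and (-lam)^3 multiply to lam^3.\<close>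
  have "{S. card S = card (UNIV :: 3 set)} = {UNIV :: 3 set}"
    using card_eq_UNIV_imp_eq_UNIV[of "_ :: 3 set"] by auto
  then have "{S :: 3 set. card S = 3} = {UNIV}" by simp
  then have "mean_curvature X N 3 p = of_int lam ^ 3 * (\<Prod>i\<in>UNIV. principal_curvatures X N p i)"
    by (simp add: mean_curvature_def curvature_coeff_def normal_sign_eq assms)
  moreover have "of_int lam ^ 3 = (of_int lam :: real)" using lam by auto
  ultimately show ?thesis by (simp add: prod_principal_curvatures assms K_def)
qed

text \<open>An ambient vector representing dH_3 on tangent vectors. Its F_2 term yields d mu_2 and
  an unwanted multiple of k_2 mu_3, which the second summand in the F_1 coefficient cancels; the
  first summand yields the derivative of k_1.\<close>

definition Y :: "real^3 \<Rightarrow> real^4" where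
  "Y p = (K / A p ^ 2) *\<^sub>R ((k 1 (p$1) / r) *\<^sub>R (e 2 *\<^sub>R F 2 (p$1)) +
     ((deriv (k 1) (p$1) * \<mu> 2 p + k 1 (p$1) * (e 2 * e 3 * k 2 (p$1) * \<mu> 3 p)) / A p) *\<^sub>R F 1 (p$1))"

lemma mean_curvature_3_derivative:
  assumes p: "p \<in> U"
  shows "frechet_derivative (mean_curvature X N 3) (at p) v = minkowski (Y p) (dX p v)"
proof -
  let ?y' = "\<lambda>v. k 1 (p$1) * d\<mu> 2 p v + (v$1 *\<^sub>R deriv (k 1) (p$1)) * \<mu> 2 p"
  have k: "(k 1 has_vector_derivative deriv (k 1) (p$1)) (at (p$1))"
    using k1_differentiable[OF proj[OF p]]
    by (simp add: DERIV_deriv_iff_real_differentiable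
        flip: has_real_derivative_iff_has_vector_derivative)
  have y: "((\<lambda>q. k 1 (q$1) * \<mu> 2 q) has_derivative ?y') (at p)"
    by (intro has_derivative_mult has_derivative_comp_nth k mu_has_derivative)
  \<comment> \<open>On \<open>U\<close>, H_3 is \<open>h\<close> applied to k_1 mu_2, so the chain
    rule applies.\<close>
  define h where "h x = K * (x / (1 - r * e 2 * x))" for x
  have A: "1 - r * e 2 * (k 1 (p$1) * \<mu> 2 p) = A p" by (simp add: A_def)
  have "(h has_real_derivative K / A p ^ 2) (at (k 1 (p$1) * \<mu> 2 p))"
    unfolding h_def using moebius_has_derivative[of "r * e 2" "k 1 (p$1) * \<mu> 2 p" K]
      A_nonzero[OF p] unfolding A by simp
  then have "((\<lambda>q. h (k 1 (q$1) * \<mu> 2 q)) has_derivative (\<lambda>v. K / A p ^ 2 * ?y' v)) (at p)"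
    using has_derivative_compose[OF y, of h "(*) (K / A p ^ 2)"] unfolding has_field_derivative_def by simp
  then have "(mean_curvature X N 3 has_derivative (\<lambda>v. K / A p ^ 2 * ?y' v)) (at p)"
    by (rule has_derivative_transform_within_open[OF _ U p])
      (simp add: mean_curvature_3 h_def A_def mult.assoc)
  then have D: "frechet_derivative (mean_curvature X N 3) (at p) v = K / A p ^ 2 * ?y' v"
    by (rule frechet_derivative_apply)
  have 1: "minkowski (F 1 (p$1)) (dX p v) = v$1 * A p"
    unfolding minkowski_commute[of "F 1 (p$1)"]
    by (simp add: dX_eq p minkowski_simps frame[OF proj[OF p]] minkowski_dP_F A_def algebra_simps)
  have 2: "minkowski (F 2 (p$1)) (dX p v) = r * (e 2 * d\<mu> 2 p v - v$1 * e 3 * k 2 (p$1) * \<mu> 3 p)"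
    unfolding minkowski_commute[of "F 2 (p$1)"]
    by (simp add: dX_eq p minkowski_simps frame[OF proj[OF p]] minkowski_dP_F)
  have "minkowski (Y p) (dX p v) = (K / A p ^ 2) *
     (k 1 (p$1) * ((e 2 * e 2) * d\<mu> 2 p v) + v$1 * deriv (k 1) (p$1) * \<mu> 2 p)"
    unfolding Y_def minkowski_simps 1 2 using r A_nonzero[OF p] by (simp add: field_simps)
  then show ?thesis by (simp add: D e_square)
qed

text \<open>The normal correction in the gradient and the term 3 H_1 H_3 N are both multiples of
  \<open>P p\<close>; \<open>a\<close> collects them, and H_1 stays unevaluated.\<close>

lemma L2_eq:
  assumes p: "p \<in> U"
  shows "\<exists>a. L2_gauss_map X N p = - of_int lam *\<^sub>R Y p + a *\<^sub>R P p"
proof -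
  obtain a where a: "surface_gradient X (mean_curvature X N 3) p = Y p + a *\<^sub>R P p"
    using surface_gradient_eqI[OF p mean_curvature_3_derivative[OF p]] by blast
  define b where "b = 3 * mean_curvature X N 1 p * mean_curvature X N 3 p"
  have "L2_gauss_map X N p = - of_int lam *\<^sub>R (Y p + a *\<^sub>R P p + b *\<^sub>R (- c *\<^sub>R P p))"
    unfolding L2_gauss_map_def a normal_sign_eq[OF p] N_eq b_def
    using lam by (auto simp: power2_eq_square)
  also have "\<dots> = - of_int lam *\<^sub>R Y p + (- of_int lam * (a - b * c)) *\<^sub>R P p"
    by (simp add: algebra_simps)
  finally show ?thesis by blast
qed

section \<open>Excluding the generalized 1-type identity\<close>

lemma frame_nondegenerate:
  assumes s: "s \<in> I"
    and "minkowski C (F 1 s) = 0" "minkowski C (F 2 s) = 0"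
      "minkowski C (F 3 s) = 0" "minkowski C (F 4 s) = 0"
  shows "C = 0"
proof -
  define L :: "real^4 \<Rightarrow> real^4"
    where "L u = u$1 *\<^sub>R F 1 s + u$2 *\<^sub>R F 2 s + u$3 *\<^sub>R F 3 s + u$4 *\<^sub>R F 4 s" for u
  have L: "linear L"
    unfolding L_def by (auto intro!: linearI simp: algebra_simps)
  have "inj L"
  proof (subst linear_injective_0[OF L], intro allI impI)
    fix u assume "L u = 0"
    then have "minkowski (L u) y = 0" for y by (simp add: minkowski_simps)
    \<comment> \<open>Pairing \<open>L u\<close> with F_i gives the i-th coordinate of
      \<open>u\<close> up to sign.\<close>
    from this[of "F 1 s"] this[of "F 2 s"] this[of "F 3 s"] this[of "F 4 s"] show "u = 0"
      by (simp add: L_def minkowski_simps frame[OF s] e_nonzero vec_eq_iff forall_4)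
  qed
  then have "surj L" using L by (simp add: linear_injective_imp_surjective)
  have "minkowski C y = 0" for y
  proof -
    obtain u where "y = L u" using \<open>surj L\<close> by (rule surjE)
    then show ?thesis by (simp add: L_def minkowski_simps assms)
  qed
  then show ?thesis by (rule minkowski_nondegenerate)
qed

lemma not_generalized_1_type: "\<not> generalized_L2_1_type_gauss_map U X N"
proof
  assume "generalized_L2_1_type_gauss_map U X N"
  then obtain m n C p0 where n: "smooth_on U n" and p0: "p0 \<in> U" "n p0 \<noteq> 0" and C: "C \<noteq> 0"
    and eq: "\<And>p. p \<in> U \<Longrightarrow> L2_gauss_map X N p = m p *\<^sub>R N p + n p *\<^sub>R C"
    unfolding generalized_L2_1_type_gauss_map_def by blast
  \<comment> \<open>\<open>N p\<close> is a multiple of \<open>P p\<close>, so the term of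
    \<open>m\<close> is absorbed in the coefficient of \<open>P p\<close>.\<close>
  have "\<exists>d. n p *\<^sub>R C = - of_int lam *\<^sub>R Y p + d *\<^sub>R P p" if p: "p \<in> U" for p
  proof -
    obtain a where "L2_gauss_map X N p = - of_int lam *\<^sub>R Y p + a *\<^sub>R P p"
      using L2_eq[OF p] by blast
    then have "n p *\<^sub>R C = - of_int lam *\<^sub>R Y p + (a + m p * c) *\<^sub>R P p"
      using eq[OF p] by (simp add: N_eq algebra_simps)
    then show ?thesis by blast
  qed
  then obtain d where d: "\<And>p. p \<in> U \<Longrightarrow> n p *\<^sub>R C = - of_int lam *\<^sub>R Y p + d p *\<^sub>R P p"
    by metis
  define G where "G i s = minkowski C (F i s)" for i s
  \<comment> \<open>\<open>Y p\<close> lies in the span of F_1 and F_2, and \<open>P p\<close> in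
    that of F_2, F_3, F_4. Components 3 and 4 therefore see only \<open>d\<close>, and component 1
    only \<open>Y\<close>.\<close>
  have nG: "n p * G i (p$1) = - of_int lam * minkowski (Y p) (F i (p$1)) + d p * minkowski (P p) (F i (p$1))"
    if "p \<in> U" for p i
    using arg_cong[OF d[OF that], of "\<lambda>y. minkowski y (F i (p$1))"]
    by (simp add: G_def minkowski_simps)
  have nG1: "n p * G 1 (p$1) = - of_int lam * (K / A p ^ 2) * ((deriv (k 1) (p$1) * \<mu> 2 p +
      k 1 (p$1) * (e 2 * e 3 * k 2 (p$1) * \<mu> 3 p)) / A p)" if "p \<in> U" for p
    using that by (simp add: nG minkowski_P_F Y_def minkowski_simps frame[OF proj])
  have nG2: "n p * G 2 (p$1) = - of_int lam * (K / A p ^ 2) * (k 1 (p$1) / r) + d p * (e 2 * \<mu> 2 p)"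
    if "p \<in> U" for p
    using that by (simp add: nG minkowski_P_F Y_def minkowski_simps frame[OF proj] e_square)
  have nG3: "n p * G 3 (p$1) = d p * (e 3 * \<mu> 3 p)" if "p \<in> U" for p
    using that by (simp add: nG minkowski_P_F Y_def minkowski_simps frame[OF proj])
  have nG4: "n p * G 4 (p$1) = d p * (e 4 * \<mu> 4 p)" if "p \<in> U" for p
    using that by (simp add: nG minkowski_P_F Y_def minkowski_simps frame[OF proj])

  define W0 where "W0 = U \<inter> n -` (- {0})"
  have W0: "open W0"
    unfolding W0_def
    by (intro continuous_open_preimage smooth_on_imp_continuous_on[OF n] U) auto
  have "continuous_on W0 (\<mu> 3)"
    using mu_has_derivative[of 3]
    by (intro continuous_at_imp_continuous_on ballI has_derivative_continuous)
  then have W: "open (W0 \<inter> \<mu> 3 -` (- {0}))"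
    by (intro continuous_open_preimage W0) auto
  \<comment> \<open>On \<open>W\<close> both \<open>n\<close> and mu_3 can be cancelled. It is
    nonempty because mu_3 cannot vanish on a whole nonempty open set.\<close>
  define W where "W = W0 \<inter> \<mu> 3 -` (- {0})"
  note W = W[folded W_def]
  have WU: "p \<in> U" and nz: "n p \<noteq> 0" and mu3: "\<mu> 3 p \<noteq> 0" if "p \<in> W" for p
    using that by (auto simp: W_def W0_def)
  have "\<exists>p\<in>W0. \<mu> 3 p \<noteq> 0"
  proof (rule ccontr)
    assume "\<not> ?thesis"
    then show False
      using mu_independent(3)[OF j lam W0, of p0 0 0 1 0] p0
      by (auto simp: W0_def \<mu>_def)
  qed
  then obtain p1 where p1: "p1 \<in> W" by (auto simp: W_def)

  have G34: "G 3 (p$1) = 0" "G 4 (p$1) = 0" if p: "p \<in> W" for p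
  proof -
    \<comment> \<open>Eliminating \<open>d\<close> between \<open>nG3\<close> and \<open>nG4\<close>
      leaves a relation between mu_3 and mu_4 whose coefficients depend on s alone.\<close>
    have *: "0 + 0 * mu j lam 2 (q$2) (q$3) + - (e 3 * G 4 (p$1)) * mu j lam 3 (q$2) (q$3) +
        (e 4 * G 3 (p$1)) * mu j lam 4 (q$2) (q$3) = 0" if q: "q \<in> W" "q$1 = p$1" for q
    proof -
      have "n q * (e 4 * \<mu> 4 q * G 3 (q$1) - e 3 * \<mu> 3 q * G 4 (q$1)) =
          e 4 * \<mu> 4 q * (n q * G 3 (q$1)) - e 3 * \<mu> 3 q * (n q * G 4 (q$1))"
        by (simp add: algebra_simps)
      also have "\<dots> = 0" unfolding nG3[OF WU[OF q(1)]] nG4[OF WU[OF q(1)]] by simp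
      finally show ?thesis using nz[OF q(1)] q(2) by (simp add: \<mu>_def algebra_simps)
    qed
    show "G 3 (p$1) = 0" "G 4 (p$1) = 0"
      using mu_independent(3,4)[OF j lam W p *] e_nonzero by auto
  qed
  have d0: "d p = 0" if "p \<in> W" for p
    using nG3[OF WU[OF that]] G34(1)[OF that] mu3[OF that] e_nonzero[of 3] by simp

  have G': "(G i has_real_derivative minkowski C D) (at s)"
    if "(F i has_vector_derivative D) (at s)" for i s D
    unfolding G_def has_real_derivative_iff_has_vector_derivative
    by (rule bounded_linear.has_vector_derivative[OF
        bounded_bilinear.bounded_linear_right[OF bounded_bilinear_minkowski] that])
  have k2G2: "k 2 (p$1) * G 2 (p$1) = 0" if p: "p \<in> W" for p
  proof -
    \<comment> \<open>The relation G_3 = 0 is differentiated with the Frenet equation of F_3; the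
      F_4 term drops out because G_4 = 0.\<close>
    have "minkowski C (- (e 2 * e 3 * k 2 (p$1)) *\<^sub>R F 2 (p$1) + k 3 (p$1) *\<^sub>R F 4 (p$1)) = 0"
      by (rule vanishing_derivative[OF W p G34(1) G'[OF frenet_equations(4)[OF proj[OF WU[OF p]]]]])
    then have "- (e 2 * e 3 * k 2 (p$1)) * G 2 (p$1) + k 3 (p$1) * G 4 (p$1) = 0"
      by (simp add: minkowski_simps G_def)
    then show ?thesis using G34(2)[OF p] e_nonzero by simp
  qed
  \<comment> \<open>Eliminate \<open>n\<close> between \<open>nG1\<close> and \<open>nG2\<close>,
    remove the mu_3 term by \<open>k2G2\<close> and clear the denominator \<open>A\<close>. The
    result is affine in mu_2 with coefficients depending on s alone, and k_1 G_1 is its constant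
    term.\<close>
  have k1G1: "k 1 (p$1) * G 1 (p$1) = 0" if p: "p \<in> W" for p
  proof (rule mu_independent(1)[OF j lam W p])
    fix q assume q: "q \<in> W" "q$1 = p$1"
    note qU = WU[OF q(1)]
    let ?s = "q$1"
    define M where "M = - of_int lam * K / A q ^ 2"
    have M: "M \<noteq> 0" using lam K_nonzero A_nonzero[OF qU] by (auto simp: M_def)
    have 2: "n q * G 2 ?s = M * (k 1 ?s / r)"
      using nG2[OF qU] d0[OF q(1)] by (simp add: M_def)
    have 1: "n q * G 1 ?s = M * ((deriv (k 1) ?s * \<mu> 2 q + k 1 ?s * (e 2 * e 3 * k 2 ?s * \<mu> 3 q)) / A q)"
      using nG1[OF qU] by (simp add: M_def)
    have "M * (k 1 ?s / r * G 1 ?s) = G 2 ?s * (n q * G 1 ?s)"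
      using arg_cong[OF 2, of "\<lambda>x. G 1 ?s * x"] by (simp only: mult_ac times_divide_eq_right)
    also have "\<dots> = M * ((deriv (k 1) ?s * \<mu> 2 q * G 2 ?s
        + k 1 ?s * (e 2 * e 3 * (k 2 ?s * G 2 ?s) * \<mu> 3 q)) / A q)"
      unfolding 1 by (simp add: algebra_simps)
    also have "\<dots> = M * (deriv (k 1) ?s * \<mu> 2 q * G 2 ?s / A q)"
      unfolding k2G2[OF q(1)] by simp
    finally have "k 1 ?s / r * G 1 ?s = deriv (k 1) ?s * \<mu> 2 q * G 2 ?s / A q"
      by (simp only: mult_left_cancel[OF M])
    then have "k 1 ?s * G 1 ?s * A q = r * deriv (k 1) ?s * \<mu> 2 q * G 2 ?s"
      using r A_nonzero[OF qU] by (simp add: field_simps)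
    then have "k 1 ?s * G 1 ?s * A q - r * deriv (k 1) ?s * \<mu> 2 q * G 2 ?s = 0"
      by simp
    also have "k 1 ?s * G 1 ?s * A q - r * deriv (k 1) ?s * \<mu> 2 q * G 2 ?s = k 1 ?s * G 1 ?s +
        (- (k 1 ?s * G 1 ?s * (r * e 2 * k 1 ?s)) - r * deriv (k 1) ?s * G 2 ?s) * \<mu> 2 q"
      by (simp add: A_def algebra_simps)
    finally show "k 1 (p$1) * G 1 (p$1) +
        (- (k 1 (p$1) * G 1 (p$1) * (r * e 2 * k 1 (p$1))) - r * deriv (k 1) (p$1) * G 2 (p$1)) *
          mu j lam 2 (q$2) (q$3) + 0 * mu j lam 3 (q$2) (q$3) + 0 * mu j lam 4 (q$2) (q$3) = 0"
      unfolding \<mu>_def q(2) by simp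
  qed
  show False
  proof (cases "\<exists>p\<in>W. G 2 (p$1) \<noteq> 0")
    case True
    then obtain p where p: "p \<in> W" "G 2 (p$1) \<noteq> 0" by blast
    \<comment> \<open>With \<open>d\<close> = 0, \<open>nG2\<close> makes \<open>n\<close> G_2 a
      multiple of k_1.\<close>
    have k1: "k 1 (q$1) \<noteq> 0" if "q \<in> W" "G 2 (q$1) \<noteq> 0" for q
      using nG2[OF WU[OF that(1)]] d0[OF that(1)] nz[OF that(1)] that(2) by auto
    define W2 where "W2 = W \<inter> (\<lambda>q. G 2 (q$1)) -` (- {0})"
    have "isCont (\<lambda>q. G 2 (q$1)) q" if "q \<in> W" for q
      using G'[OF frenet_equations(3)[OF proj[OF WU[OF that]]]]
      unfolding has_real_derivative_iff_has_vector_derivative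
      by (rule has_derivative_continuous[OF has_derivative_comp_nth])
    then have "continuous_on W (\<lambda>q. G 2 (q$1))"
      by (simp add: continuous_at_imp_continuous_on)
    then have "open W2" unfolding W2_def
      by (intro continuous_open_preimage W) auto
    moreover have "p \<in> W2" using p by (simp add: W2_def)
    moreover have "G 1 (q$1) = 0" if "q \<in> W2" for q
      using k1[of q] k1G1[of q] that by (auto simp: W2_def)
    \<comment> \<open>G_1 vanishes on the open set \<open>W2\<close>, hence so does its derivative
      k_1 G_2, although both factors are nonzero at \<open>p\<close>.\<close>
    ultimately have "minkowski C (k 1 (p$1) *\<^sub>R F 2 (p$1)) = 0"
      by (rule vanishing_derivative[OF _ _ _ G'[OF frenet_equations(2)[OF proj[OF WU[OF p(1)]]]]])
    then show False using k1[OF p] p(2) by (simp add: minkowski_simps G_def)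
  next
    case False
    then have G2: "G 2 (p$1) = 0" if "p \<in> W" for p using that by blast
    have k1: "k 1 (p$1) = 0" if "p \<in> W" for p
      using nG2[OF WU[OF that]] d0[OF that] G2[OF that] lam K_nonzero r A_nonzero[OF WU[OF that]] by auto
    have k1': "(k 1 has_real_derivative deriv (k 1) (p1$1)) (at (p1$1))"
      using k1_differentiable[OF proj[OF WU[OF p1]]]
      by (simp add: DERIV_deriv_iff_real_differentiable)
    \<comment> \<open>Since k_1 vanishes on \<open>W\<close>, so does its derivative. Then
      \<open>nG1\<close> gives G_1 = 0, and \<open>C\<close> is orthogonal to the whole frame at
      \<open>p1\<close>.\<close>
    have "deriv (k 1) (p1$1) = 0"
      by (rule vanishing_derivative[where g = "k 1", OF W p1 k1 k1'])
    then have "G 1 (p1$1) = 0"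
      using nG1[OF WU[OF p1]] k1[OF p1] nz[OF p1] by simp
    then have "C = 0"
      using G2[OF p1] G34[OF p1] unfolding G_def
      by (intro frame_nondegenerate[OF proj[OF WU[OF p1]]])
    then show False using C by contradiction
  qed
qed

end

theorem theorem13:
  fixes j :: nat and lam :: int and r :: real
    and I :: "real set" and U :: "(real^3) set"
    and \<beta> :: "real \<Rightarrow> real^4" and F :: "nat \<Rightarrow> real \<Rightarrow> real^4" and k :: "nat \<Rightarrow> real \<Rightarrow> real"
  assumes "j \<in> {2, 3, 4}" and "lam \<in> {1, -1}" and "r > 0"
    and "open I" and "is_interval I" and "I \<noteq> {}"
    and "frenet_curve j I \<beta> F k"
    and "open U" and "connected U" and "(\<lambda>p. p$1) ` U = I"
    and "immersion_on U (tube \<beta> F r j lam)"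
  shows "\<not> generalized_L2_1_type_gauss_map U (tube \<beta> F r j lam) (tube_gauss_map F j lam)"
proof -
  interpret framed_tube j lam r I U \<beta> F k
    using assms by unfold_locales auto
  show ?thesis by (rule not_generalized_1_type)
qed

end
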